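(* The set $\mathcal{C}(\partial D,\mathbb{C})\setminus\overline{\mathrm{Pol}(\partial D)}$ is strongly $\mathfrak{c}$-algebrable.
   Context: $D=\{z\in\mathbb{C}:|z|<1\}$ and $\partial D$ is the unit circle. $\mathcal{C}(\partial D,\mathbb{C})$ is the Banach algebra of continuous functions $\partial D\to\mathbb{C}$ with the sup-norm and pointwise operations. $\mathrm{Pol}(\partial D):=\{f|_{\partial D}:f\in\mathbb{C}[z]\}$ (complex polynomials in one variable restricted to $\partial D$), with norm closure $\overline{\mathrm{Pol}(\partial D)}$. $\mathfrak{c}$ is the cardinality of the continuum. For a (not necessarily unital) algebra $V$, a subset $M\subseteq V$ and a cardinal $\kappa$, $M$ is strongly $\kappa$-algebrable if $M\cup\{0\}$ contains a $\kappa$-generated free algebra. For commutative $V$ this means: there is a set $B\subseteq V$ with $|B|=\kappa$ such that for every $n\in\mathbb{N}$, every nonzero polynomial $P$ in $n$ variables without constant term (with coefficients in the base field), and all distinct $f_1,\dots,f_n\in B$, one has $P(f_1,\dots,f_n)\neq 0$ and $P(f_1,\dots,f_n)\in M$. *)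

theory Defs
  imports "HOL-Analysis.Analysis" "HOL-Library.Poly_Mapping"
begin

unbundle cardinal_syntax

text \<open>
  Polynomials in countably many variables \<open>X\<^sub>0, X\<^sub>1, \<dots>\<close> over \<open>'k\<close> are elements of the ring
  \<open>(nat \<Rightarrow>\<^sub>0 nat) \<Rightarrow>\<^sub>0 'k\<close>: a monomial maps variable indices to exponents, a polynomial maps
  monomials to coefficients.
\<close>

type_synonym 'k mpolynomial = "(nat \<Rightarrow>\<^sub>0 nat) \<Rightarrow>\<^sub>0 'k"

definition mpoly_in_vars :: "nat \<Rightarrow> ('k::zero) mpolynomial \<Rightarrow> bool" where
  "mpoly_in_vars n P \<longleftrightarrow> (\<forall>m \<in> Poly_Mapping.keys P. Poly_Mapping.keys m \<subseteq> {..<n})"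

definition mpoly_const_coeff :: "('k::zero) mpolynomial \<Rightarrow> 'k" where
  "mpoly_const_coeff P = Poly_Mapping.lookup P 0"

definition mpoly_eval :: "('k::comm_semiring_1) mpolynomial \<Rightarrow> (nat \<Rightarrow> 'k) \<Rightarrow> 'k" where
  "mpoly_eval P x =
     (\<Sum>m \<in> Poly_Mapping.keys P.
        Poly_Mapping.lookup P m * (\<Prod>i \<in> Poly_Mapping.keys m. x i ^ Poly_Mapping.lookup m i))"

text \<open>
  A function on a set \<open>S\<close> is represented by its extensional representative (constantly
  \<^const>\<open>undefined\<close> off \<open>S\<close>), so that equality of functions on \<open>S\<close> is HOL equality. The algebra
  operations on such functions are the pointwise ones, whence \<open>P(f\<^sub>0, \<dots>, f\<^bsub>n-1\<^esub>)\<close> is the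
  following function and the zero element is \<open>\<lambda>x\<in>S. 0\<close>.
\<close>

definition mpoly_eval_fun ::
    "'a set \<Rightarrow> ('k::comm_semiring_1) mpolynomial \<Rightarrow> (nat \<Rightarrow> 'a \<Rightarrow> 'k) \<Rightarrow> 'a \<Rightarrow> 'k" where
  "mpoly_eval_fun S P f = (\<lambda>x\<in>S. mpoly_eval P (\<lambda>i. f i x))"

text \<open>
  Strong \<open>\<kappa>\<close>-algebrability of \<open>M\<close> in a (commutative, possibly non-unital) algebra \<open>V\<close> of
  functions \<open>S \<rightarrow> 'k\<close> with pointwise operations. The cardinal \<open>\<kappa>\<close> is given as a cardinal order.
\<close>

definition strongly_algebrable ::
    "'a set \<Rightarrow> ('a \<Rightarrow> 'k::field) set \<Rightarrow> 'c rel \<Rightarrow> ('a \<Rightarrow> 'k) set \<Rightarrow> bool" where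
  "strongly_algebrable S V \<kappa> M \<longleftrightarrow>
     M \<subseteq> V \<and>
     (\<exists>B. B \<subseteq> V \<and> |B| =o \<kappa> \<and>
        (\<forall>(n::nat) (P::'k mpolynomial) (f::nat \<Rightarrow> 'a \<Rightarrow> 'k).
           mpoly_in_vars n P \<and> P \<noteq> 0 \<and> mpoly_const_coeff P = 0 \<and>
           inj_on f {..<n} \<and> f ` {..<n} \<subseteq> B \<longrightarrow>
             mpoly_eval_fun S P f \<noteq> (\<lambda>x\<in>S. 0) \<and> mpoly_eval_fun S P f \<in> M))"

definition continuum :: "real rel" where
  "continuum = |UNIV :: real set|"

abbreviation unit_circle :: "complex set" where
  "unit_circle \<equiv> sphere 0 1"

text \<open>
  The library's metric space of bounded continuous functions with the supremum metric; by
  compactness of the circle, boundedness is automatic (lemma \<open>circle_functions_eq\<close>).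
\<close>

definition circle_space :: "(complex \<Rightarrow> complex) metric" where
  "circle_space = cfunspace (top_of_set unit_circle) euclidean_metric"

definition circle_functions :: "(complex \<Rightarrow> complex) set" where
  "circle_functions = mspace circle_space"

definition circle_polynomials :: "(complex \<Rightarrow> complex) set" where
  "circle_polynomials = {restrict (poly p) unit_circle | p :: complex poly. True}"

definition circle_polynomials_closure :: "(complex \<Rightarrow> complex) set" where
  "circle_polynomials_closure = mtopology_of circle_space closure_of circle_polynomials"

lemma circle_functions_eq:
  "circle_functions = {f. f \<in> extensional unit_circle \<and> continuous_on unit_circle f}"
proof -
  have "compactin (top_of_set unit_circle) (topspace (top_of_set unit_circle))"
    by (simp add: compactin_subtopology)
  from compactin_mspace_cfunspace[OF this, of euclidean_metric] show ?thesis
    by (simp add: circle_functions_def circle_space_def)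
qed

lemma circle_dist_eq:
  assumes "f \<in> circle_functions" "g \<in> circle_functions"
  shows "mdist circle_space f g = (SUP z\<in>unit_circle. norm (f z - g z))"
proof -
  have "(1::complex) \<in> unit_circle"
    by simp
  then have "unit_circle \<noteq> {}"
    by blast
  moreover have "f \<in> Met_TC.fspace unit_circle" "g \<in> Met_TC.fspace unit_circle"
    using assms cfunspace_subset_funspace[of "top_of_set unit_circle" euclidean_metric]
    unfolding circle_functions_def circle_space_def by auto
  ultimately show ?thesis
    by (simp add: circle_space_def mdist_cfunspace_eq_mdist_funspace Met_TC.fdist_def dist_norm)
qed

lemma circle_polynomials_subset: "circle_polynomials \<subseteq> circle_functions"
proof -
  have "continuous_on unit_circle (restrict (poly p) unit_circle)" for p :: "complex poly"
    by (rule continuous_on_eq[of _ "poly p"]) (auto intro!: continuous_intros)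
  then show ?thesis
    by (auto simp: circle_polynomials_def circle_functions_eq simp del: restrict_apply)
qed

end

theory Submission
  imports Defs "HOL-Complex_Analysis.Conformal_Mappings" "HOL-Real_Asymp.Real_Asymp"
begin

text \<open>
  Uniform limits of polynomials on the circle satisfy a uniqueness principle: such a limit that
  vanishes on the closed lower half circle vanishes on the whole circle
  (\<open>circle_polynomials_closure_vanishing_on_half_circle\<close>). It therefore suffices to find continuum
  many continuous functions that vanish there and are algebraically independent. A polynomial
  without constant term in such functions again vanishes on the lower half circle, it is not zero
  if the polynomial is not, and hence it lies outside the closure.

  For the uniqueness principle, the limit extends by the maximum modulus principle to a
  function \<open>G\<close> that is continuous on the closed disc and holomorphic inside. Of two antipodal points
  of the circle at least one lies in the lower half, so \<open>G(z) G(-z)\<close> is zero on the circle, and by the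
  maximum modulus principle in the disc. Since a product of holomorphic functions on a connected set
  vanishes only if one factor does, \<open>G = 0\<close>.

  For the independent functions, let \<open>f\<^sub>a(z) = exp (- (Im z)\<^bsup>-a\<^esup>)\<close> on the upper half circle and
  \<open>f\<^sub>a(z) = 0\<close> on the lower one, for \<open>a > 0\<close>. In terms of \<open>s = 1 / Im z\<close>, the monomial
  with exponents \<open>m\<^sub>i\<close> in the functions with parameters \<open>a\<^sub>i\<close> is \<open>exp (- E\<^sub>m(s))\<close>, where \<open>E\<^sub>m(s)\<close> is
  the sum of the \<open>m\<^sub>i * s powr a\<^sub>i\<close>. For distinct monomials the difference of these exponents tends to plus or minus infinity
  with \<open>s\<close>, because it is governed by the largest \<open>a\<^sub>i\<close> at which the monomials differ
  (\<open>sum_powr_at_top_or_at_bot\<close>). So one monomial of a given nonzero polynomial dominates all others as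
  \<open>s\<close> grows, and the polynomial cannot vanish identically
  (\<open>mpoly_eval_exp_powr_nonzero\<close>).
\<close>

section \<open>Boundary uniqueness for uniform limits of polynomials\<close>

text \<open>
  Uniform convergence propagates from the circle into the disc: the maximum modulus principle, applied
  to differences of the polynomials, turns the Cauchy property on the circle into the Cauchy property
  on the closed disc, where uniform limits stay holomorphic.
\<close>

lemma uniform_limit_poly_circle_extends:
  fixes p :: "nat \<Rightarrow> complex poly"
  assumes "uniform_limit (sphere 0 1) (\<lambda>k. poly (p k)) g sequentially"
  obtains G where "continuous_on (cball 0 1) G" "G holomorphic_on ball 0 1"
    "\<And>z. z \<in> sphere 0 1 \<Longrightarrow> G z = g z"
proof -
  have "uniformly_Cauchy_on (cball 0 1) (\<lambda>k. poly (p k))"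
  proof (rule uniformly_Cauchy_onI)
    fix e :: real assume "e > 0"
    have "uniformly_Cauchy_on (sphere 0 1) (\<lambda>k. poly (p k))"
      using assms uniformly_convergent_Cauchy uniformly_convergent_on_def by blast
    with \<open>e > 0\<close> obtain M where M: "dist (poly (p m) z) (poly (p n) z) < e / 2"
      if "z \<in> sphere 0 1" "m \<ge> M" "n \<ge> M" for z m n
      unfolding uniformly_Cauchy_on_def by (meson half_gt_zero)
    have "dist (poly (p m) z) (poly (p n) z) < e"
      if "z \<in> cball 0 1" "m \<ge> M" "n \<ge> M" for z m n
    proof -
      have "norm (poly (p m) z - poly (p n) z) \<le> e / 2"
      proof (rule maximum_modulus_frontier[where S = "cball 0 1" and f = "\<lambda>z. poly (p m) z - poly (p n) z"])
        show "norm (poly (p m) w - poly (p n) w) \<le> e / 2" if "w \<in> frontier (cball 0 1)" for w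
          using M[of w m n] that \<open>m \<ge> M\<close> \<open>n \<ge> M\<close> by (simp add: dist_norm)
      qed (use that in \<open>auto intro!: holomorphic_intros continuous_intros\<close>)
      then show ?thesis
        using \<open>e > 0\<close> by (simp add: dist_norm)
    qed
    then show "\<exists>M. \<forall>z\<in>cball 0 1. \<forall>m\<ge>M. \<forall>n\<ge>M. dist (poly (p m) z) (poly (p n) z) < e"
      by blast
  qed
  then obtain G where G: "uniform_limit (cball 0 1) (\<lambda>k. poly (p k)) G sequentially"
    using Cauchy_uniformly_convergent uniformly_convergent_on_def by blast
  have "\<forall>\<^sub>F k in sequentially. continuous_on (cball 0 1) (poly (p k)) \<and> poly (p k) holomorphic_on ball 0 1"
    by (auto intro!: always_eventually continuous_intros holomorphic_intros)
  then have "continuous_on (cball 0 1) G" "G holomorphic_on ball 0 1"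
    using holomorphic_uniform_limit[OF _ G] by auto
  moreover have "G z = g z" if "z \<in> sphere 0 1" for z
    using that tendsto_uniform_limitI[OF assms that] tendsto_uniform_limitI[OF G, of z]
    by (metis LIMSEQ_unique mem_cball mem_sphere order_refl)
  ultimately show thesis
    using that by blast
qed

text \<open>
  The product \<open>G(w) G(-w)\<close> reduces vanishing on half of the circle to vanishing on all of it, since
  the half circle and its antipodal image cover the circle.
\<close>

lemma disc_algebra_vanishing_on_half_circle:
  fixes G :: "complex \<Rightarrow> complex"
  assumes cont: "continuous_on (cball 0 1) G" and hol: "G holomorphic_on ball 0 1"
    and zero: "\<And>z. z \<in> sphere 0 1 \<Longrightarrow> Im z \<le> 0 \<Longrightarrow> G z = 0"
    and z: "z \<in> cball 0 1"
  shows "G z = 0"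
proof -
  have cont': "continuous_on (cball 0 1) (\<lambda>w. G (- w))"
    by (rule continuous_on_compose2[OF cont]) (auto intro!: continuous_intros)
  have "(G \<circ> uminus) holomorphic_on ball 0 1"
    by (rule holomorphic_on_compose_gen[OF _ hol]) (auto intro!: holomorphic_intros)
  then have hol': "(\<lambda>w. G (- w)) holomorphic_on ball 0 1"
    by (simp add: o_def)
  have prod_zero: "G w * G (- w) = 0" if "w \<in> ball 0 1" for w
  proof -
    have "norm (G w * G (- w)) \<le> 0"
    proof (rule maximum_modulus_frontier[where S = "cball 0 1" and f = "\<lambda>w. G w * G (- w)"])
      fix u :: complex assume "u \<in> frontier (cball 0 1)"
      then have "u \<in> sphere 0 1" "- u \<in> sphere 0 1"
        by auto
      then have "G u = 0 \<or> G (- u) = 0"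
        using zero[of u] zero[of "- u"] by (cases "Im u \<le> 0") auto
      then show "norm (G u * G (- u)) \<le> 0"
        by auto
    qed (use that cont cont' hol hol' in \<open>auto intro!: holomorphic_intros continuous_intros\<close>)
    then show ?thesis by simp
  qed
  have ball_zero: "G w = 0" if w: "w \<in> ball 0 1" for w
  proof (rule ccontr)
    assume "G w \<noteq> 0"
    \<comment> \<open>Near \<open>w\<close> the first factor of the product has no zero, so the second one vanishes on an open
      set and then, by the identity theorem, everywhere, in particular at \<open>-w\<close>.\<close>
    define U where "U = {u \<in> ball 0 1. G u \<in> - {0}}"
    have "open U"
      using continuous_open_preimage[OF holomorphic_on_imp_continuous_on[OF hol], of "- {0}"]
      by (simp add: U_def vimage_def Int_def open_Compl)
    moreover have "w \<in> U" "U \<subseteq> ball 0 1"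
      using \<open>G w \<noteq> 0\<close> w by (auto simp: U_def)
    moreover have "G (- u) = 0" if "u \<in> U" for u
      using that prod_zero[of u] by (auto simp: U_def)
    ultimately have "G (- (- w)) = 0"
      by (intro analytic_continuation_open[of U "ball 0 1" "\<lambda>w. G (- w)" "\<lambda>_. 0" "- w"])
         (use hol' w in auto)
    with \<open>G w \<noteq> 0\<close> show False by simp
  qed
  have "closure (ball 0 1) = cball (0::complex) 1"
    by simp
  then show ?thesis
    using continuous_constant_on_closure[of "ball 0 1" G 0 z] cont ball_zero z by auto
qed

lemma circle_polynomials_closure_uniform_limit:
  assumes "g \<in> circle_polynomials_closure"
  obtains p where "uniform_limit (sphere 0 1) (\<lambda>k. poly (p k)) g sequentially"
proof -
  interpret M: Metric_space "mspace circle_space" "mdist circle_space"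
    by simp
  have g: "g \<in> circle_functions"
    and approx: "\<And>r. r > 0 \<Longrightarrow> \<exists>q\<in>circle_polynomials. q \<in> M.mball g r"
    using assms
    unfolding circle_polynomials_closure_def mtopology_of_def M.metric_closure_of circle_functions_def
    by auto
  have poly_close: "\<exists>p. \<forall>z\<in>sphere 0 1. norm (g z - poly p z) < r" if r: "r > 0" for r
  proof -
    obtain q where q: "q \<in> circle_polynomials" "q \<in> M.mball g r"
      using approx[OF r] by blast
    then obtain p where p: "q = restrict (poly p) (sphere 0 1)"
      by (auto simp: circle_polynomials_def)
    have qc: "q \<in> circle_functions"
      using q circle_polynomials_subset by blast
    have "continuous_on (sphere 0 1) (\<lambda>z. norm (g z - q z))"
      using g qc by (auto simp: circle_functions_eq intro!: continuous_intros)
    then have bdd: "bdd_above ((\<lambda>z. norm (g z - q z)) ` sphere 0 1)"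
      by (intro bounded_imp_bdd_above compact_imp_bounded compact_continuous_image) auto
    have "norm (g z - poly p z) < r" if z: "z \<in> sphere 0 1" for z
    proof -
      have "norm (g z - q z) \<le> mdist circle_space g q"
        unfolding circle_dist_eq[OF g qc] by (rule cSUP_upper[OF z bdd])
      also have "\<dots> < r"
        using q by simp
      finally show ?thesis
        using z by (simp add: p)
    qed
    then show ?thesis by blast
  qed
  have "\<forall>k. \<exists>p. \<forall>z\<in>sphere 0 1. norm (g z - poly p z) < inverse (real (Suc k))"
    by (intro allI poly_close) simp
  then obtain p where p: "\<And>k z. z \<in> sphere 0 1 \<Longrightarrow> norm (g z - poly (p k) z) < inverse (real (Suc k))"
    by metis
  have "uniform_limit (sphere 0 1) (\<lambda>k. poly (p k)) g sequentially"
  proof (rule uniform_limitI)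
    fix e :: real assume "e > 0"
    have "\<forall>\<^sub>F k in sequentially. inverse (real (Suc k)) < e"
      using LIMSEQ_inverse_real_of_nat \<open>e > 0\<close> order_tendstoD(2) by blast
    then show "\<forall>\<^sub>F k in sequentially. \<forall>z\<in>sphere 0 1. dist (poly (p k) z) (g z) < e"
      by eventually_elim (metis p dist_norm norm_minus_commute order_less_trans)
  qed
  then show thesis
    by (rule that)
qed

lemma circle_polynomials_closure_vanishing_on_half_circle:
  assumes "g \<in> circle_polynomials_closure"
    and "\<And>z. z \<in> sphere 0 1 \<Longrightarrow> Im z \<le> 0 \<Longrightarrow> g z = 0"
    and "z \<in> sphere 0 1"
  shows "g z = 0"
proof -
  obtain p where "uniform_limit (sphere 0 1) (\<lambda>k. poly (p k)) g sequentially"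
    using circle_polynomials_closure_uniform_limit[OF assms(1)] by blast
  then obtain G where "continuous_on (cball 0 1) G" "G holomorphic_on ball 0 1"
      and G: "\<And>w. w \<in> sphere 0 1 \<Longrightarrow> G w = g w"
    using uniform_limit_poly_circle_extends by blast
  then have "G z = 0"
    using disc_algebra_vanishing_on_half_circle[of G z] assms(2,3) by auto
  then show ?thesis
    using G assms(3) by simp
qed

section \<open>Algebraic independence of exponentials of distinct powers\<close>

text \<open>
  The term with the largest exponent wins: after division by \<open>s powr a j\<close> for this exponent \<open>a j\<close>,
  all other terms tend to zero and \<open>c j \<noteq> 0\<close> remains, whose sign decides the alternative.
\<close>

lemma sum_powr_at_top_or_at_bot:
  fixes a c :: "'i \<Rightarrow> real"
  assumes "finite I" "I \<noteq> {}" "inj_on a I" "\<And>i. i \<in> I \<Longrightarrow> a i > 0" "\<And>i. i \<in> I \<Longrightarrow> c i \<noteq> 0"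
  shows "filterlim (\<lambda>s. \<Sum>i\<in>I. c i * s powr a i) at_top at_top \<or>
         filterlim (\<lambda>s. - (\<Sum>i\<in>I. c i * s powr a i)) at_top at_top"
proof -
  have "Max (a ` I) \<in> a ` I"
    using assms by (intro Max_in) auto
  then obtain j where j: "j \<in> I" "a j = Max (a ` I)"
    by (metis imageE)
  then have less: "a i < a j" if "i \<in> I" "i \<noteq> j" for i
    using that assms(1,3) by (metis Max_ge finite_imageI imageI inj_onD order_le_less)
  have lim: "((\<lambda>s. \<Sum>i\<in>I. c i * s powr (a i - a j)) \<longlongrightarrow> (\<Sum>i\<in>I. if i = j then c j else 0)) at_top"
  proof (rule tendsto_sum)
    fix i assume i: "i \<in> I"
    show "((\<lambda>s. c i * s powr (a i - a j)) \<longlongrightarrow> (if i = j then c j else 0)) at_top"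
    proof (cases "i = j")
      case True
      have "\<forall>\<^sub>F s in at_top. c j = c i * s powr (a i - a j)"
        using eventually_gt_at_top[of 0] by eventually_elim (simp add: True)
      then show ?thesis
        using True by (simp add: tendsto_eventually eventually_mono)
    next
      case False
      have "((\<lambda>s. s powr (a i - a j)) \<longlongrightarrow> 0) at_top"
        using tendsto_neg_powr[OF _ filterlim_ident, of "a i - a j"] less[OF i False] by simp
      from tendsto_mult_right_zero[OF this] show ?thesis
        using False by simp
    qed
  qed
  have lim: "((\<lambda>s. \<Sum>i\<in>I. c i * s powr (a i - a j)) \<longlongrightarrow> c j) at_top"
    using lim j(1) assms(1) by simp
  have top: "filterlim (\<lambda>s::real. s powr a j) at_top at_top"
    using assms(4)[OF j(1)] by (intro real_powr_at_top) auto
  have eq: "\<forall>\<^sub>F s in at_top. (\<Sum>i\<in>I. c i * s powr (a i - a j)) * s powr a j = (\<Sum>i\<in>I. c i * s powr a i)"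
    using eventually_gt_at_top[of 0]
    by eventually_elim (simp add: sum_distrib_right mult.assoc flip: powr_add)
  show ?thesis
  proof (cases "c j > 0")
    case True
    have "filterlim (\<lambda>s. (\<Sum>i\<in>I. c i * s powr (a i - a j)) * s powr a j) at_top at_top"
      by (rule filterlim_tendsto_pos_mult_at_top[OF lim True top])
    then show ?thesis
      unfolding filterlim_cong[OF refl refl eq] ..
  next
    case False
    then have "- c j > 0"
      using assms(5)[OF j(1)] by simp
    then have "filterlim (\<lambda>s. (- (\<Sum>i\<in>I. c i * s powr (a i - a j))) * s powr a j) at_top at_top"
      using filterlim_tendsto_pos_mult_at_top[OF tendsto_minus[OF lim] _ top] by simp
    moreover have "\<forall>\<^sub>F s in at_top. (- (\<Sum>i\<in>I. c i * s powr (a i - a j))) * s powr a j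
        = - (\<Sum>i\<in>I. c i * s powr a i)"
      using eq by eventually_elim simp
    ultimately have "filterlim (\<lambda>s. - (\<Sum>i\<in>I. c i * s powr a i)) at_top at_top"
      by (simp only: filterlim_cong[OF refl refl])
    then show ?thesis ..
  qed
qed

text \<open>
  The monomials of \<open>P\<close> become exponentials \<open>exp (- E m s)\<close>, and comparing the growth of the \<open>E m\<close>
  orders the monomials of \<open>P\<close> linearly. If \<open>P\<close> vanished identically, dividing by the exponential of the
  least element \<open>m0\<close> and letting \<open>s\<close> tend to infinity would make the coefficient of \<open>m0\<close> zero. Only
  \<open>s \<ge> 1\<close> is of interest because these are the reciprocals of the heights of points on the upper half
  circle.
\<close>

lemma mpoly_eval_exp_powr_nonzero:
  fixes a :: "nat \<Rightarrow> real" and P :: "complex mpolynomial"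
  assumes "mpoly_in_vars n P" "P \<noteq> 0" "inj_on a {..<n}" "\<And>i. i < n \<Longrightarrow> a i > 0"
  shows "\<exists>s\<ge>1. mpoly_eval P (\<lambda>i. complex_of_real (exp (- (s powr a i)))) \<noteq> 0"
proof (rule ccontr)
  assume "\<not> ?thesis"
  then have vanish: "mpoly_eval P (\<lambda>i. complex_of_real (exp (- (s powr a i)))) = 0" if "s \<ge> 1" for s
    using that by blast
  define K where "K = Poly_Mapping.keys P"
  define E where "E m s = (\<Sum>i<n. real (Poly_Mapping.lookup m i) * s powr a i)" for m :: "nat \<Rightarrow>\<^sub>0 nat" and s
  have K: "finite K" "K \<noteq> {}"
    using assms(2) by (auto simp: K_def)
  have keys_sub: "Poly_Mapping.keys m \<subseteq> {..<n}" if "m \<in> K" for m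
    using assms(1) that by (auto simp: K_def mpoly_in_vars_def)
  have monomial: "(\<Prod>i\<in>Poly_Mapping.keys m. complex_of_real (exp (- (s powr a i))) ^ Poly_Mapping.lookup m i)
      = complex_of_real (exp (- E m s))" if "m \<in> K" for m s
  proof -
    have "(\<Prod>i\<in>Poly_Mapping.keys m. exp (- (s powr a i)) ^ Poly_Mapping.lookup m i)
        = (\<Prod>i<n. exp (- (s powr a i)) ^ Poly_Mapping.lookup m i)"
      by (rule prod.mono_neutral_left) (use keys_sub[OF that] in \<open>auto simp: in_keys_iff\<close>)
    also have "\<dots> = exp (- E m s)"
      by (simp add: E_def exp_sum flip: exp_of_nat_mult sum_negf)
    finally show ?thesis
      by (metis (no_types, lifting) of_real_power of_real_prod prod.cong)
  qed
  have comparable: "filterlim (\<lambda>s. E m s - E m' s) at_top at_top \<or> filterlim (\<lambda>s. E m' s - E m s) at_top at_top"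
    if "m \<in> K" "m' \<in> K" "m \<noteq> m'" for m m'
  proof -
    define c where "c i = real (Poly_Mapping.lookup m i) - real (Poly_Mapping.lookup m' i)" for i
    \<comment> \<open>Only variables with different exponents in the two monomials survive in \<open>E m - E m'\<close>.\<close>
    define I where "I = {i. i < n \<and> c i \<noteq> 0}"
    obtain i where i: "Poly_Mapping.lookup m i \<noteq> Poly_Mapping.lookup m' i"
      using \<open>m \<noteq> m'\<close> by (metis poly_mapping_eqI)
    then have "i < n"
      using keys_sub[OF that(1)] keys_sub[OF that(2)] by (metis in_keys_iff lessThan_iff subsetD)
    then have "i \<in> I"
      using i by (simp add: I_def c_def)
    have diff: "E m s - E m' s = (\<Sum>i\<in>I. c i * s powr a i)" for s
    proof -
      have "E m s - E m' s = (\<Sum>i<n. c i * s powr a i)"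
        by (simp add: E_def c_def sum_subtractf left_diff_distrib)
      also have "\<dots> = (\<Sum>i\<in>I. c i * s powr a i)"
        by (rule sum.mono_neutral_right) (auto simp: I_def)
      finally show ?thesis .
    qed
    have diff': "E m' s - E m s = - (\<Sum>i\<in>I. c i * s powr a i)" for s
      using diff[of s] by simp
    have "I \<subseteq> {..<n}"
      by (auto simp: I_def)
    then have "inj_on a I"
      using assms(3) inj_on_subset by blast
    show ?thesis
      unfolding diff diff'
      by (rule sum_powr_at_top_or_at_bot) (use \<open>i \<in> I\<close> \<open>inj_on a I\<close> assms(4) in \<open>auto simp: I_def\<close>)
  qed
  have dominates_trans: "transp_on K (\<lambda>m m'. filterlim (\<lambda>s. E m' s - E m s) at_top at_top)"
  proof (rule transp_onI)
    fix m m' m'' assume "filterlim (\<lambda>s. E m' s - E m s) at_top at_top"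
      "filterlim (\<lambda>s. E m'' s - E m' s) at_top at_top"
    from filterlim_at_top_add_at_top[OF this] show "filterlim (\<lambda>s. E m'' s - E m s) at_top at_top"
      by simp
  qed
  have dominates_total: "totalp_on K (\<lambda>m m'. filterlim (\<lambda>s. E m' s - E m s) at_top at_top)"
    using comparable by (intro totalp_onI) blast
  obtain m0 where m0: "m0 \<in> K"
      "\<And>m. m \<in> K \<Longrightarrow> m \<noteq> m0 \<Longrightarrow> filterlim (\<lambda>s. E m s - E m0 s) at_top at_top"
    using Finite_Set.bex_least_element[OF K dominates_trans dominates_total] by blast
  define c where "c = Poly_Mapping.lookup P"
  have "((\<lambda>s. \<Sum>m\<in>K. c m * complex_of_real (exp (- (E m s - E m0 s))))
      \<longlongrightarrow> (\<Sum>m\<in>K. if m = m0 then c m0 else 0)) at_top"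
  proof (rule tendsto_sum)
    fix m assume m: "m \<in> K"
    show "((\<lambda>s. c m * complex_of_real (exp (- (E m s - E m0 s)))) \<longlongrightarrow> (if m = m0 then c m0 else 0)) at_top"
    proof (cases "m = m0")
      case False
      have "filterlim (\<lambda>s. - (E m s - E m0 s)) at_bot at_top"
        using m0(2)[OF m False] by (simp only: filterlim_uminus_at_top)
      then have "((\<lambda>s. exp (- (E m s - E m0 s))) \<longlongrightarrow> 0) at_top"
        by (rule filterlim_compose[OF exp_at_bot])
      then have "((\<lambda>s. complex_of_real (exp (- (E m s - E m0 s)))) \<longlongrightarrow> complex_of_real 0) at_top"
        by (rule tendsto_of_real)
      then show ?thesis
        using False tendsto_mult_right_zero by auto
    qed simp
  qed
  then have lim: "((\<lambda>s. \<Sum>m\<in>K. c m * complex_of_real (exp (- (E m s - E m0 s)))) \<longlongrightarrow> c m0) at_top"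
    using m0(1) K(1) by simp
  have "\<forall>\<^sub>F s in at_top. (\<Sum>m\<in>K. c m * complex_of_real (exp (- (E m s - E m0 s)))) = 0"
    using eventually_ge_at_top[of 1]
  proof eventually_elim
    case (elim s)
    have "(\<Sum>m\<in>K. c m * complex_of_real (exp (- (E m s - E m0 s))))
        = (\<Sum>m\<in>K. c m * complex_of_real (exp (- E m s))) * complex_of_real (exp (E m0 s))"
      by (simp add: sum_distrib_right mult.assoc flip: of_real_mult exp_add)
    also have "(\<Sum>m\<in>K. c m * complex_of_real (exp (- E m s))) = 0"
      using vanish[OF elim] monomial by (simp add: mpoly_eval_def c_def flip: K_def)
    finally show ?case by simp
  qed
  then have "c m0 = 0"
    by (intro tendsto_unique[OF trivial_limit_at_top_linorder lim] tendsto_eventually)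
  with m0(1) show False
    by (simp add: K_def c_def in_keys_iff)
qed

section \<open>Functions vanishing on the lower half circle\<close>

definition flat_bump :: "real \<Rightarrow> real \<Rightarrow> real" where
  "flat_bump a t = (if t > 0 then exp (- (t powr - a)) else 0)"

definition circle_bump :: "real \<Rightarrow> complex \<Rightarrow> complex" where
  "circle_bump a = (\<lambda>z\<in>sphere 0 1. complex_of_real (flat_bump a (Im z)))"

text \<open>
  The only delicate point is \<open>0\<close>, where \<open>t powr - a\<close> tends to infinity from the right because \<open>a > 0\<close>.
\<close>

lemma continuous_flat_bump:
  assumes "a > 0"
  shows "continuous_on UNIV (flat_bump a)"
proof -
  have at_right: "((\<lambda>t. exp (- (t powr - a))) \<longlongrightarrow> 0) (at_right 0)"
  proof -
    have "filterlim (\<lambda>t. inverse t powr a) at_top (at_right (0::real))"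
      using assms filterlim_compose[OF real_powr_at_top filterlim_inverse_at_top_right] by simp
    moreover have "\<forall>\<^sub>F t in at_right (0::real). inverse t powr a = t powr - a"
      using eventually_at_right_less[of 0] by eventually_elim (simp add: powr_minus inverse_powr)
    ultimately have "filterlim (\<lambda>t. t powr - a) at_top (at_right (0::real))"
      by (simp only: filterlim_cong[OF refl refl])
    then have "filterlim (\<lambda>t. - (t powr - a)) at_bot (at_right (0::real))"
      by (simp add: filterlim_uminus_at_top)
    then show ?thesis
      by (rule filterlim_compose[OF exp_at_bot])
  qed
  have "continuous_on ({0..} \<union> {..0}) (flat_bump a)"
  proof (rule continuous_on_closed_Un)
    show "continuous_on {0..} (flat_bump a)"
      unfolding continuous_on_def
    proof
      fix t :: real assume "t \<in> {0..}"
      show "(flat_bump a \<longlongrightarrow> flat_bump a t) (at t within {0..})"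
      proof (cases "t = 0")
        case True
        have "\<forall>\<^sub>F t in at_right 0. exp (- (t powr - a)) = flat_bump a t"
          using eventually_at_right_less[of 0] by eventually_elim (simp add: flat_bump_def)
        then have "(flat_bump a \<longlongrightarrow> 0) (at_right 0)"
          by (rule Lim_transform_eventually[OF at_right])
        then show ?thesis
          by (simp add: True flat_bump_def at_within_Ici_at_right)
      next
        case False
        then have t: "t > 0"
          using \<open>t \<in> {0..}\<close> by simp
        have "((\<lambda>t. exp (- (t powr - a))) \<longlongrightarrow> exp (- (t powr - a))) (at t)"
          using t by (intro tendsto_intros) auto
        moreover have "\<forall>\<^sub>F u in at t. exp (- (u powr - a)) = flat_bump a u"
          using eventually_at_in_open'[of "{0<..}" t] t
          by (auto simp: flat_bump_def elim!: eventually_mono)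
        ultimately have "(flat_bump a \<longlongrightarrow> exp (- (t powr - a))) (at t)"
          by (rule Lim_transform_eventually)
        then show ?thesis
          using t tendsto_within_subset[OF _ subset_UNIV] by (simp add: flat_bump_def)
      qed
    qed
    show "continuous_on {..0} (flat_bump a)"
      by (rule continuous_on_eq[of _ "\<lambda>_. 0"]) (auto simp: flat_bump_def)
  qed auto
  moreover have "{0..} \<union> {..0} = (UNIV :: real set)"
    by auto
  ultimately show ?thesis by simp
qed

lemma circle_bump_in_circle_functions:
  assumes "a > 0"
  shows "circle_bump a \<in> circle_functions"
proof -
  have "continuous_on (sphere 0 1) (\<lambda>z. complex_of_real (flat_bump a (Im z)))"
    by (intro continuous_intros continuous_on_compose2[OF continuous_flat_bump[OF assms]]) auto
  then have "continuous_on (sphere 0 1) (circle_bump a)"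
    by (rule continuous_on_eq) (simp add: circle_bump_def)
  then show ?thesis
    by (simp add: circle_functions_eq circle_bump_def)
qed

text \<open>
  The reciprocal \<open>1 / s\<close> serves as the height of the point, which turns the behaviour of the functions
  near the real axis into growth as \<open>s\<close> tends to infinity.
\<close>

lemma circle_point_of_height:
  assumes "s \<ge> 1"
  obtains z where "z \<in> sphere 0 1" "\<And>a. circle_bump a z = complex_of_real (exp (- (s powr a)))"
proof -
  define z where "z = Complex (sqrt (1 - (1 / s)\<^sup>2)) (1 / s)"
  have "(1 / s)\<^sup>2 \<le> 1"
    using assms by (simp add: power_le_one)
  then have "z \<in> sphere 0 1"
    by (simp add: z_def cmod_def)
  moreover have "circle_bump a z = complex_of_real (exp (- (s powr a)))" for a
  proof -
    have "(1 / s) powr - a = s powr a"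
      using assms by (simp add: powr_minus powr_divide)
    then show ?thesis
      using \<open>z \<in> sphere 0 1\<close> assms by (simp add: circle_bump_def flat_bump_def z_def)
  qed
  ultimately show thesis
    using that by blast
qed

lemma inj_circle_bump: "inj circle_bump"
proof (rule injI)
  fix a b assume eq: "circle_bump a = circle_bump b"
  obtain z where "\<And>a. circle_bump a z = complex_of_real (exp (- (2 powr a)))"
    using circle_point_of_height[of 2] by auto
  then have "exp (- (2 powr a)) = exp (- (2 powr b :: real))"
    using eq by (metis of_real_eq_iff)
  then have "(2::real) powr a = 2 powr b"
    by simp
  then show "a = b"
    by (simp add: powr_inj)
qed

lemma mpoly_eval_fun_in_circle_functions:
  assumes "mpoly_in_vars n P" "f ` {..<n} \<subseteq> circle_functions"
  shows "mpoly_eval_fun (sphere 0 1) P f \<in> circle_functions"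
proof -
  have "continuous_on (sphere 0 1) (f i)" if "m \<in> Poly_Mapping.keys P" "i \<in> Poly_Mapping.keys m" for m i
    using assms that by (auto simp: circle_functions_eq mpoly_in_vars_def image_subset_iff subset_iff)
  then have "continuous_on (sphere 0 1) (\<lambda>z. mpoly_eval P (\<lambda>i. f i z))"
    unfolding mpoly_eval_def by (intro continuous_intros) auto
  then have "continuous_on (sphere 0 1) (mpoly_eval_fun (sphere 0 1) P f)"
    by (rule continuous_on_eq) (simp add: mpoly_eval_fun_def)
  then show ?thesis
    by (simp add: circle_functions_eq mpoly_eval_fun_def)
qed

text \<open>
  This is where the absence of a constant term enters: it makes polynomial expressions in functions
  that vanish on the lower half circle vanish there as well.
\<close>

lemma mpoly_eval_at_zero:
  assumes "mpoly_in_vars n P" "\<And>i. i < n \<Longrightarrow> x i = 0"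
  shows "mpoly_eval P x = mpoly_const_coeff P"
proof -
  have "(\<Prod>i\<in>Poly_Mapping.keys m. x i ^ Poly_Mapping.lookup m i) = (if m = 0 then 1 else 0)"
    if "m \<in> Poly_Mapping.keys P" for m
  proof (cases "m = 0")
    case False
    then obtain i where "i \<in> Poly_Mapping.keys m"
      by fastforce
    moreover from this have "x i = 0"
      using assms that by (auto simp: mpoly_in_vars_def)
    ultimately show ?thesis
      using False by (auto simp: in_keys_iff zero_power intro!: prod_zero bexI[of _ i])
  qed simp
  then have "mpoly_eval P x = (\<Sum>m\<in>Poly_Mapping.keys P. if m = 0 then Poly_Mapping.lookup P m else 0)"
    unfolding mpoly_eval_def by (intro sum.cong) auto
  also have "\<dots> = mpoly_const_coeff P"
    by (simp add: mpoly_const_coeff_def in_keys_iff)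
  finally show ?thesis .
qed

theorem theorem3p23:
  shows "strongly_algebrable unit_circle circle_functions continuum
           (circle_functions - circle_polynomials_closure)"
  unfolding strongly_algebrable_def
proof (intro conjI exI allI impI)
  let ?B = "circle_bump ` {0<..}"
  show "circle_functions - circle_polynomials_closure \<subseteq> circle_functions"
    by blast
  show "?B \<subseteq> circle_functions"
    using circle_bump_in_circle_functions by auto
  \<comment> \<open>The exponential function reparametrises the positive exponents by all reals.\<close>
  have "bij_betw (\<lambda>b::real. circle_bump (exp b)) UNIV ?B"
    unfolding bij_betw_def
  proof
    show "inj (\<lambda>b::real. circle_bump (exp b))"
      using inj_circle_bump by (auto simp: inj_def)
    have "range (exp :: real \<Rightarrow> real) = {0<..}"
      by (auto intro: exp_ln[symmetric])
    then show "range (\<lambda>b::real. circle_bump (exp b)) = ?B"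
      by (metis image_image)
  qed
  then show "|?B| =o continuum"
    unfolding continuum_def using card_of_ordIsoI ordIso_symmetric by blast
next
  fix n :: nat and P :: "complex mpolynomial" and f :: "nat \<Rightarrow> complex \<Rightarrow> complex"
  \<comment> \<open>The point \<open>z\<close> below, where \<open>?g\<close> is not zero, serves twice: it shows \<open>?g \<noteq> 0\<close>, and it
    contradicts the uniqueness principle should \<open>?g\<close> be in the closure.\<close>
  let ?g = "mpoly_eval_fun unit_circle P f"
  assume H: "mpoly_in_vars n P \<and> P \<noteq> 0 \<and> mpoly_const_coeff P = 0 \<and>
      inj_on f {..<n} \<and> f ` {..<n} \<subseteq> circle_bump ` {0<..}"
  then have "\<forall>i. \<exists>a. i < n \<longrightarrow> a > 0 \<and> f i = circle_bump a"
    by (auto simp: image_subset_iff image_iff)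
  then obtain a where a: "\<And>i. i < n \<Longrightarrow> a i > 0" "\<And>i. i < n \<Longrightarrow> f i = circle_bump (a i)"
    by metis
  have eval_cong: "mpoly_eval P x = mpoly_eval P y" if "\<And>i. i < n \<Longrightarrow> x i = y i" for x y
    unfolding mpoly_eval_def
    using H that by (intro sum.cong prod.cong arg_cong2[where f = "(*)"] refl)
      (force simp: mpoly_in_vars_def)
  have "inj_on a {..<n}"
    using H a(2) by (intro inj_onI) (metis inj_onD lessThan_iff)
  then obtain s where s: "s \<ge> 1" "mpoly_eval P (\<lambda>i. complex_of_real (exp (- (s powr a i)))) \<noteq> 0"
    using mpoly_eval_exp_powr_nonzero[of n P a] H a(1) by blast
  obtain z where z: "z \<in> unit_circle" "\<And>a. circle_bump a z = complex_of_real (exp (- (s powr a)))"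
    using circle_point_of_height[OF s(1)] by blast
  have "?g z = mpoly_eval P (\<lambda>i. complex_of_real (exp (- (s powr a i))))"
    using z a(2) by (auto simp: mpoly_eval_fun_def intro: eval_cong)
  then have nz: "?g z \<noteq> 0"
    using s(2) by simp
  then show "?g \<noteq> (\<lambda>z\<in>unit_circle. 0)"
    using z(1) by auto
  have "f ` {..<n} \<subseteq> circle_functions"
    using a circle_bump_in_circle_functions by auto
  then have "?g \<in> circle_functions"
    using mpoly_eval_fun_in_circle_functions H by blast
  moreover have "?g \<notin> circle_polynomials_closure"
  proof
    assume g: "?g \<in> circle_polynomials_closure"
    have "?g w = 0" if "w \<in> unit_circle" "Im w \<le> 0" for w
      using mpoly_eval_at_zero[of n P "\<lambda>i. f i w"] H a(2) that
      by (simp add: mpoly_eval_fun_def circle_bump_def flat_bump_def)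
    from circle_polynomials_closure_vanishing_on_half_circle[OF g this z(1)] nz
    show False
      by simp
  qed
  ultimately show "?g \<in> circle_functions - circle_polynomials_closure"
    by blast
qed

end
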